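(* Let $\mu_0$ be a probability measure on $\mathscr{B}(\mathbb{R})$ possessing moments of every order, let $\sigma^2=\int_{\mathbb{R}}x^2\mu_0(dx)$, and let $\mu(\cdot,t)$ be the solution of the (Fourier-transformed) Kac equation with initial datum $\mu_0$. If there are a function $\rho:[0,+\infty)\to[0,+\infty)$ with $\rho(t)\to0$ as $t\to+\infty$ and a positive constant $C$ such that $$d_{\mathrm{TV}}(\mu(\cdot,t);\gamma_\sigma)\le C\,e^{-t}\rho(t)\qquad\text{for every }t\ge0,$$ then $\mu(\cdot,t)=\gamma_\sigma(\cdot)$ for every $t\ge0$.
   Context: Kac equation in Fourier form: for a probability measure $\mu_0$ on $\mathscr{B}(\mathbb{R})$ with characteristic function $\varphi_0(\xi)=\int e^{i\xi x}\mu_0(dx)$, consider $$\frac{\partial\varphi}{\partial t}(\xi,t)=\frac{1}{2\pi}\int_0^{2\pi}\varphi(\xi\cos\theta,t)\,\varphi(\xi\sin\theta,t)\,d\theta-\varphi(\xi,t),\qquad \varphi(\xi,0)=\varphi_0(\xi).$$ It has a unique solution $\varphi$, and for each $t\ge0$, $\varphi(\cdot,t)$ is the characteristic function of a probability measure $\mu(\cdot,t)$, called the solution with initial datum $\mu_0$. It is given by the Wild series $\varphi(\xi,t)=\sum_{n\ge1}e^{-t}(1-e^{-t})^{n-1}\hat q_n(\xi;\varphi_0)$ with $\hat q_1=\varphi_0$, $\hat q_n=\frac{1}{n-1}\sum_{k=1}^{n-1}\hat q_k\star\hat q_{n-k}$ $(n\ge2)$, where $(g_1\star g_2)(\xi)=\frac1{2\pi}\int_0^{2\pi}g_1(\xi\cos\theta)g_2(\xi\sin\theta)\,d\theta$.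 $\gamma_\sigma$ is the Gaussian distribution with mean $0$ and variance $\sigma^2$. For probability measures $P,Q$ on the Borel class $\mathscr{B}(\mathbb{R})$, $d_{\mathrm{TV}}(P;Q)=\sup_{B\in\mathscr{B}(\mathbb{R})}|P(B)-Q(B)|$. *)

theory Defs
  imports "HOL-Probability.Probability"
begin

definition wild_convolution :: "(real \<Rightarrow> complex) \<Rightarrow> (real \<Rightarrow> complex) \<Rightarrow> real \<Rightarrow> complex" where
  "wild_convolution g1 g2 \<xi> =
     (1 / (2 * pi)) *\<^sub>R (LBINT \<theta>:{0..2 * pi}. g1 (\<xi> * cos \<theta>) * g2 (\<xi> * sin \<theta>))"

text \<open>The Cauchy problem for the Kac equation in Fourier form. Time ranges over the half-line
  \<open>t \<ge> 0\<close>, so the time derivative at \<open>t = 0\<close> is one-sided.\<close>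

definition solves_fourier_kac :: "(real \<Rightarrow> complex) \<Rightarrow> (real \<Rightarrow> real \<Rightarrow> complex) \<Rightarrow> bool" where
  "solves_fourier_kac \<phi>0 \<phi> \<longleftrightarrow>
     (\<forall>\<xi>. \<phi> \<xi> 0 = \<phi>0 \<xi>) \<and>
     (\<forall>\<xi>. \<forall>t\<ge>0. ((\<lambda>s. \<phi> \<xi> s) has_vector_derivative
        (wild_convolution (\<lambda>\<eta>. \<phi> \<eta> t) (\<lambda>\<eta>. \<phi> \<eta> t) \<xi> - \<phi> \<xi> t)) (at t within {0..}))"

text \<open>The family \<open>\<mu>\<close> of probability measures is the solution with initial datum \<open>\<mu>0\<close>;
  values of \<open>\<mu>\<close> at negative times are irrelevant.\<close>

definition kac_solution :: "real measure \<Rightarrow> (real \<Rightarrow> real measure) \<Rightarrow> bool" where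
  "kac_solution \<mu>0 \<mu> \<longleftrightarrow>
     (\<forall>t\<ge>0. real_distribution (\<mu> t)) \<and>
     solves_fourier_kac (char \<mu>0) (\<lambda>\<xi> t. char (\<mu> t) \<xi>)"

text \<open>The centred Gaussian law with variance \<open>\<sigma>\<^sup>2\<close>. For \<open>\<sigma> = 0\<close> this is the point mass at 0,
  whereas \<^term>\<open>normal_density 0 0\<close> is identically 0.\<close>

definition gaussian :: "real \<Rightarrow> real measure" where
  "gaussian \<sigma> = (if \<sigma> = 0 then return borel 0 else density lborel (normal_density 0 \<sigma>))"

definition tv_dist :: "real measure \<Rightarrow> real measure \<Rightarrow> real" where
  "tv_dist P Q = (SUP B\<in>sets borel. \<bar>measure P B - measure Q B\<bar>)"

end

theory Submission
  imports Defs
begin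

text \<open>Write \<open>\<phi>\<close> for the solution, \<open>g\<close> for the Gaussian characteristic function, and
  \<open>D = exp t * (\<phi> - g)\<close>. The total variation bound makes \<open>D\<close> tend to 0 pointwise as \<open>t\<close> grows.
  The imaginary part of \<open>\<phi>\<close> decays exactly like \<open>exp (- t)\<close>, so it vanishes. For the real
  part, \<open>\<partial>D/\<partial>t\<close> is the circle mean of \<open>D(\<xi> cos \<theta>) \<phi>(\<xi> sin \<theta>) + g(\<xi> cos \<theta>) D(\<xi> sin \<theta>)\<close>. If
  \<open>a \<xi>\<^bsup>2m\<^esup>\<close> were the first nonzero Taylor term of \<open>D\<close> at time 0, it would be amplified by the factor
  \<open>exp (\<kappa>\<^sub>m t)\<close>, where \<open>\<kappa>\<^sub>m > 0\<close> is the circle mean of \<open>cos\<^bsup>2m\<^esup> + sin\<^bsup>2m\<^esup>\<close>; since \<open>\<kappa>\<^sub>m\<close> is strictly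
  decreasing in \<open>m\<close>, the remainder of order \<open>\<xi>\<^bsup>2m+2\<^esup>\<close> grows no faster, which contradicts
  \<open>D \<longlonglongrightarrow> 0\<close> for small \<open>\<xi>\<close>. Hence all even moments of the initial datum are Gaussian, and
  these determine the real part of its characteristic function.\<close>

section \<open>Averages over the circle\<close>

definition circle_mean :: "(real \<Rightarrow> real) \<Rightarrow> real" where
  "circle_mean f = integral {0..2 * pi} f / (2 * pi)"

lemma circle_mean_mono:
  assumes "continuous_on UNIV f" "continuous_on UNIV g" "\<And>\<theta>. f \<theta> \<le> g \<theta>"
  shows "circle_mean f \<le> circle_mean g"
  unfolding circle_mean_def
  by (intro divide_right_mono integral_le integrable_continuous_real continuous_on_subset[OF assms(1)]
      continuous_on_subset[OF assms(2)]) (use assms in auto)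

lemma abs_circle_mean_le:
  assumes "continuous_on UNIV f" "continuous_on UNIV g" "\<And>\<theta>. \<bar>f \<theta>\<bar> \<le> g \<theta>"
  shows "\<bar>circle_mean f\<bar> \<le> circle_mean g"
proof -
  have "norm (integral {0..2*pi} f) \<le> integral {0..2*pi} g"
    by (intro integral_norm_bound_integral integrable_continuous_real continuous_on_subset[OF assms(1)]
      continuous_on_subset[OF assms(2)]) (use assms in auto)
  then show ?thesis
    by (simp add: circle_mean_def abs_div divide_right_mono)
qed

lemma circle_mean_const [simp]: "circle_mean (\<lambda>_. c) = c"
  by (simp add: circle_mean_def)

lemma circle_mean_cmult [simp]: "circle_mean (\<lambda>\<theta>. c * f \<theta>) = c * circle_mean f"
  by (simp add: circle_mean_def)

lemma circle_mean_add:
  assumes "continuous_on UNIV f" "continuous_on UNIV g"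
  shows "circle_mean (\<lambda>\<theta>. f \<theta> + g \<theta>) = circle_mean f + circle_mean g"
proof -
  have "f integrable_on {0..2*pi}" "g integrable_on {0..2*pi}"
    using assms by (auto intro!: integrable_continuous_real elim: continuous_on_subset)
  then show ?thesis
    by (simp add: circle_mean_def integral_add add_divide_distrib)
qed

lemma circle_mean_diff:
  assumes "continuous_on UNIV f" "continuous_on UNIV g"
  shows "circle_mean (\<lambda>\<theta>. f \<theta> - g \<theta>) = circle_mean f - circle_mean g"
  using circle_mean_add[of f "\<lambda>\<theta>. (-1) * g \<theta>"] circle_mean_cmult[of "-1" g] assms
  by (simp add: continuous_intros)

section \<open>Eigenvalues of the linearised gain operator\<close>

text \<open>Linearised at the constant 1, the gain term sends \<open>h\<close> to the circle mean of
  \<open>h (\<xi> * cos \<theta>) + h (\<xi> * sin \<theta>)\<close>. The monomial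
  \<open>\<xi> ^ (2 * m)\<close> is an eigenfunction of this operator, with the eigenvalue defined
  here.\<close>

definition collision_eigenvalue :: "nat \<Rightarrow> real" where
  "collision_eigenvalue m = circle_mean (\<lambda>\<theta>. cos \<theta> ^ (2 * m) + sin \<theta> ^ (2 * m))"

lemma collision_eigenvalue_1: "collision_eigenvalue 1 = 1"
  by (simp add: collision_eigenvalue_def)

text \<open>The integrands differ by \<open>cos \<theta> ^ (2 * m) * (sin \<theta>)\<^sup>2 + sin
  \<theta> ^ (2 * m) * (cos \<theta>)\<^sup>2\<close>, which is continuous, nonnegative and positive
  at \<open>pi / 4\<close>, so its mean is positive.\<close>

lemma collision_eigenvalue_Suc_less: "collision_eigenvalue (Suc m) < collision_eigenvalue m"
proof -
  define h :: "real \<Rightarrow> real" where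
    "h = (\<lambda>\<theta>. (cos \<theta> ^ (2 * m) + sin \<theta> ^ (2 * m)) - (cos \<theta> ^ (2 * Suc m) + sin \<theta> ^ (2 * Suc m)))"
  have h_alt: "h \<theta> = (cos \<theta>)\<^sup>2 ^ m * (1 - (cos \<theta>)\<^sup>2) + (sin \<theta>)\<^sup>2 ^ m * (1 - (sin \<theta>)\<^sup>2)" for \<theta>
    by (simp only: h_def power_mult power_Suc) (simp add: algebra_simps del: power_Suc)
  have h_nonneg: "0 \<le> h \<theta>" for \<theta>
    unfolding h_alt by (intro add_nonneg_nonneg mult_nonneg_nonneg)
      (auto simp: abs_square_le_1)
  have h_cont: "continuous_on S h" for S
    unfolding h_def by (intro continuous_intros)
  have "h (pi / 4) > 0"
    unfolding h_alt by (simp add: cos_45 sin_45 power_divide add_pos_pos)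
  moreover have "pi / 4 \<in> {0..2 * pi}"
    by simp
  ultimately have "integral {0..2 * pi} h \<noteq> 0"
    using integral_eq_0_iff[OF h_cont, of 0 "2 * pi"] h_nonneg by fastforce
  moreover have "integral {0..2 * pi} h \<ge> 0"
    by (intro integral_nonneg integrable_continuous_real h_cont h_nonneg)
  ultimately have "circle_mean h > 0"
    by (simp add: circle_mean_def)
  then show ?thesis
    unfolding h_def collision_eigenvalue_def
    by (subst (asm) circle_mean_diff) (auto intro!: continuous_intros)
qed

text \<open>The eigenvalue of the next index is nonnegative, and the decrease is strict.\<close>

lemma collision_eigenvalue_pos: "0 < collision_eigenvalue m"
proof -
  have "circle_mean (\<lambda>_. 0) \<le> collision_eigenvalue (Suc m)"
    unfolding collision_eigenvalue_def
    by (intro circle_mean_mono continuous_intros add_nonneg_nonneg zero_le_even_power) auto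
  then show ?thesis
    using collision_eigenvalue_Suc_less[of m] by simp
qed

section \<open>A growth estimate with power weights\<close>

lemma even_power_le_1:
  fixes x :: real
  assumes "\<bar>x\<bar> \<le> 1"
  shows "x ^ (2 * m) \<le> 1"
  using power_le_one[of "\<bar>x\<bar>" "2 * m"] assms by (simp add: power_even_abs)

lemma power_over_fact_tendsto_0: "(\<lambda>n. x ^ n / fact n) \<longlonglongrightarrow> 0" for x :: real
  using summable_LIMSEQ_zero[OF summable_exp[of x]] by (simp add: divide_inverse mult.commute)

lemma has_derivative_power_over_fact:
  fixes s :: real
  shows "((\<lambda>s. (2 * s) ^ Suc n / fact (Suc n)) has_real_derivative 2 * ((2 * s) ^ n / fact n))
    (at s within S)"
proof -
  have "((\<lambda>s. (2 * s) ^ Suc n / fact (Suc n)) has_real_derivative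
      ((1 + real n) * (2 * (2 * s) ^ n)) / fact (Suc n)) (at s within S)"
    by (intro DERIV_cdivide DERIV_power_Suc) (auto intro!: derivative_eq_intros)
  also have "((1 + real n) * (2 * (2 * s) ^ n)) / fact (Suc n) = 2 * ((2 * s) ^ n / fact n)"
    by (simp add: divide_simps)
  finally show ?thesis .
qed

text \<open>A bound on \<open>sup\<^sub>\<xi> \<bar>u \<xi> t\<bar> / \<xi> ^ (2 * p)\<close> cannot be obtained from Gronwall's inequality, because
  nothing guarantees that this supremum is finite for \<open>t > 0\<close>. Instead, the crude bound
  \<open>B * (1 + \<xi> ^ (2 * q))\<close> is improved by iteration.\<close>

lemma weighted_gronwall:
  fixes u u' :: "real \<Rightarrow> real \<Rightarrow> real"
  assumes cont: "\<And>t. 0 \<le> t \<Longrightarrow> t \<le> T \<Longrightarrow> continuous_on UNIV (\<lambda>\<xi>. u \<xi> t)"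
    and deriv: "\<And>\<xi> t. 0 \<le> t \<Longrightarrow> t \<le> T \<Longrightarrow>
      ((\<lambda>s. u \<xi> s) has_vector_derivative u' \<xi> t) (at t within {0..})"
    and bound: "\<And>\<xi> t. 0 \<le> t \<Longrightarrow> t \<le> T \<Longrightarrow>
      \<bar>u' \<xi> t\<bar> \<le> circle_mean (\<lambda>\<theta>. \<bar>u (\<xi> * cos \<theta>) t\<bar> + \<bar>u (\<xi> * sin \<theta>) t\<bar>)
        + K * exp (k * t) * \<xi> ^ (2 * p)"
    and crude: "\<And>\<xi> t. 0 \<le> t \<Longrightarrow> t \<le> T \<Longrightarrow> \<bar>u \<xi> t\<bar> \<le> B * (1 + \<xi> ^ (2 * q))"
    and init: "\<And>\<xi>. \<bar>u \<xi> 0\<bar> \<le> A * \<xi> ^ (2 * p)"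
    and A: "0 \<le> A" "collision_eigenvalue p * A + K \<le> k * A"
    and t: "0 \<le> t" "t \<le> T"
  shows "\<bar>u \<xi> t\<bar> \<le> A * exp (k * t) * \<xi> ^ (2 * p)"
proof -
  have B: "B \<ge> 0"
  proof -
    have "0 \<le> B * (1 + 1 ^ (2 * q))"
      using crude[of t 1] t by linarith
    then show ?thesis
      by simp
  qed
  \<comment> \<open>Each pass integrates the previous bound in time. The factor 2 counts the cosine
    and the sine term, so the error runs through the terms of the series of
    \<open>exp (2 * t)\<close>.\<close>
  have iterate: "\<bar>u \<xi> t\<bar> \<le> A * exp (k * t) * \<xi> ^ (2 * p) + B * ((2 * t) ^ n / fact n) * (1 + \<xi> ^ (2 * q))"
    if "0 \<le> t" "t \<le> T" for n \<xi> t
    using that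
  proof (induction n arbitrary: \<xi> t)
    case 0
    then show ?case
      using crude[of t \<xi>] A by (simp add: add_increasing)
  next
    case (Suc n)
    define w where "w = (\<lambda>s. A * exp (k * s) * \<xi> ^ (2 * p)
      + B * ((2 * s) ^ Suc n / fact (Suc n)) * (1 + \<xi> ^ (2 * q)))"
    define w' where "w' = (\<lambda>s. A * (k * exp (k * s)) * \<xi> ^ (2 * p)
      + B * (2 * ((2 * s) ^ n / fact n)) * (1 + \<xi> ^ (2 * q)))"
    have w_deriv: "(w has_vector_derivative w' s) (at s within S)" for s S
    proof -
      define e :: "real \<Rightarrow> real" where "e = (\<lambda>s. (2 * s) ^ Suc n / fact (Suc n))"
      have "(e has_real_derivative 2 * ((2 * s) ^ n / fact n)) (at s within S)"
        unfolding e_def by (rule has_derivative_power_over_fact)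
      then have "((\<lambda>s. A * exp (k * s) * \<xi> ^ (2 * p) + B * e s * (1 + \<xi> ^ (2 * q)))
          has_real_derivative A * (k * exp (k * s)) * \<xi> ^ (2 * p)
          + B * (2 * ((2 * s) ^ n / fact n)) * (1 + \<xi> ^ (2 * q))) (at s within S)"
        by (auto intro!: derivative_eq_intros)
      then show ?thesis
        by (simp only: e_def w_def w'_def has_real_derivative_iff_has_vector_derivative)
    qed
    have u'_le: "\<bar>u' \<xi> s\<bar> \<le> w' s" if s: "0 \<le> s" "s \<le> T" for s
    proof -
      define \<beta> where "\<beta> = B * ((2 * s) ^ n / fact n)"
      define \<alpha> where "\<alpha> = A * exp (k * s) * \<xi> ^ (2 * p)"
      have \<beta>: "0 \<le> \<beta>"
        using B s by (simp add: \<beta>_def)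
      have u_cont: "continuous_on UNIV (\<lambda>\<theta>. \<bar>u (\<xi> * cos \<theta>) s\<bar> + \<bar>u (\<xi> * sin \<theta>) s\<bar>)"
        by (intro continuous_intros continuous_on_compose2[OF cont[OF s]]) auto
      \<comment> \<open>The factor \<open>c ^ (2 * p)\<close> is kept because its mean yields the
        eigenvalue; the crude weight only has to not increase when \<open>\<xi>\<close> shrinks to
        \<open>\<xi> * c\<close>.\<close>
      have pointwise: "\<bar>u (\<xi> * c) s\<bar> \<le> \<alpha> * c ^ (2 * p) + \<beta> * (1 + \<xi> ^ (2 * q))" if "\<bar>c\<bar> \<le> 1" for c
      proof -
        have "\<xi> ^ (2 * q) * c ^ (2 * q) \<le> \<xi> ^ (2 * q)"
          using even_power_le_1[OF that, of q] by (simp add: mult_left_le)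
        then have "\<beta> * (1 + (\<xi> * c) ^ (2 * q)) \<le> \<beta> * (1 + \<xi> ^ (2 * q))"
          using \<beta> by (intro mult_left_mono) (auto simp: power_mult_distrib)
        then show ?thesis
          using Suc.IH[OF s, of "\<xi> * c"] by (simp add: \<alpha>_def \<beta>_def power_mult_distrib mult_ac)
      qed
      have "circle_mean (\<lambda>\<theta>. \<bar>u (\<xi> * cos \<theta>) s\<bar> + \<bar>u (\<xi> * sin \<theta>) s\<bar>)
          \<le> circle_mean (\<lambda>\<theta>. \<alpha> * (cos \<theta> ^ (2 * p) + sin \<theta> ^ (2 * p)) + 2 * (\<beta> * (1 + \<xi> ^ (2 * q))))"
      proof (rule circle_mean_mono[OF u_cont])
        show "\<bar>u (\<xi> * cos \<theta>) s\<bar> + \<bar>u (\<xi> * sin \<theta>) s\<bar>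
          \<le> \<alpha> * (cos \<theta> ^ (2 * p) + sin \<theta> ^ (2 * p)) + 2 * (\<beta> * (1 + \<xi> ^ (2 * q)))" for \<theta>
          using pointwise[of "cos \<theta>"] pointwise[of "sin \<theta>"] by (simp add: distrib_left)
      qed (intro continuous_intros)
      also have "\<dots> = \<alpha> * collision_eigenvalue p + 2 * (\<beta> * (1 + \<xi> ^ (2 * q)))"
        by (subst circle_mean_add) (auto intro!: continuous_intros simp: collision_eigenvalue_def)
      finally have "\<bar>u' \<xi> s\<bar> \<le> \<alpha> * collision_eigenvalue p + 2 * (\<beta> * (1 + \<xi> ^ (2 * q)))
          + K * exp (k * s) * \<xi> ^ (2 * p)"
        using bound[OF s, of \<xi>] by linarith
      also have "\<dots> = (collision_eigenvalue p * A + K) * (exp (k * s) * \<xi> ^ (2 * p))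
          + 2 * (\<beta> * (1 + \<xi> ^ (2 * q)))"
        by (simp add: \<alpha>_def algebra_simps)
      \<comment> \<open>The hypothesis relating \<open>A\<close>, \<open>K\<close> and
        \<open>k\<close> makes \<open>A * exp (k * t) * \<xi> ^ (2 * p)\<close> a
        supersolution.\<close>
      also have "\<dots> \<le> k * A * (exp (k * s) * \<xi> ^ (2 * p)) + 2 * (\<beta> * (1 + \<xi> ^ (2 * q)))"
        using A by (intro add_right_mono mult_right_mono) auto
      also have "\<dots> = w' s"
        by (simp add: w'_def \<beta>_def algebra_simps)
      finally show ?thesis .
    qed
    show ?case
    proof (cases "t = 0")
      case True
      then show ?thesis
        using init[of \<xi>] by simp
    next
      case False
      \<comment> \<open>Mean value inequality with the majorant \<open>w\<close>, the bound claimed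
        at stage \<open>Suc n\<close>. It needs an interval of positive length, hence the case split
        on \<open>t\<close>.\<close>
      have "norm (u \<xi> t - u \<xi> 0) \<le> w t - w 0"
      proof (rule differentiable_bound_general)
        show "0 < t"
          using False Suc.prems by simp
        show "continuous_on {0..t} (\<lambda>s. u \<xi> s)"
          unfolding continuous_on_eq_continuous_within
        proof
          fix s assume "s \<in> {0..t}"
          then have "((\<lambda>s. u \<xi> s) has_vector_derivative u' \<xi> s) (at s within {0..t})"
            using Suc.prems by (intro has_vector_derivative_within_subset[OF deriv]) auto
          then show "continuous (at s within {0..t}) (\<lambda>s. u \<xi> s)"
            by (rule has_vector_derivative_continuous)
        qed
        show "continuous_on {0..t} w"
          using w_deriv by (meson continuous_on_eq_continuous_within has_vector_derivative_continuous)
        show "((\<lambda>s. u \<xi> s) has_vector_derivative u' \<xi> s) (at s)" if "0 < s" "s < t" for s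
        proof -
          have "at s within {0..} = at s"
            using that by (intro at_within_interior) auto
          then show ?thesis
            using deriv[of s \<xi>] that Suc.prems by simp
        qed
        show "(w has_vector_derivative w' s) (at s)" for s
          by (rule w_deriv)
        show "norm (u' \<xi> s) \<le> w' s" if "0 < s" "s < t" for s
          using u'_le[of s] that Suc.prems by simp
      qed
      moreover have "w 0 = A * \<xi> ^ (2 * p)"
        by (simp add: w_def)
      ultimately have "\<bar>u \<xi> t\<bar> \<le> w t"
        using init[of \<xi>] by (simp add: abs_le_iff)
      then show ?thesis
        by (simp add: w_def)
    qed
  qed
  have "(\<lambda>n. A * exp (k * t) * \<xi> ^ (2 * p) + B * ((2 * t) ^ n / fact n) * (1 + \<xi> ^ (2 * q)))
      \<longlonglongrightarrow> A * exp (k * t) * \<xi> ^ (2 * p) + B * 0 * (1 + \<xi> ^ (2 * q))"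
    by (intro tendsto_intros power_over_fact_tendsto_0)
  then show ?thesis
    using iterate[OF t, of \<xi>] by (intro LIMSEQ_le_const[of _ "A * exp (k * t) * \<xi> ^ (2 * p)"]) auto
qed

section \<open>Real solutions and their deviation from the Gaussian\<close>

text \<open>Here \<open>r\<close> abstracts a real-valued characteristic function evolving by the
  Kac equation, and \<open>c\<close> is half the variance of the limiting Gaussian.\<close>

locale real_kac_flow =
  fixes r :: "real \<Rightarrow> real \<Rightarrow> real" and c :: real
  assumes c_nonneg: "0 \<le> c"
    and abs_r_le_1: "\<And>\<xi> t. 0 \<le> t \<Longrightarrow> \<bar>r \<xi> t\<bar> \<le> 1"
    and r_cont: "\<And>t. 0 \<le> t \<Longrightarrow> continuous_on UNIV (\<lambda>\<xi>. r \<xi> t)"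
    and r_deriv: "\<And>\<xi> t. 0 \<le> t \<Longrightarrow> ((\<lambda>s. r \<xi> s) has_vector_derivative
      circle_mean (\<lambda>\<theta>. r (\<xi> * cos \<theta>) t * r (\<xi> * sin \<theta>) t) - r \<xi> t) (at t within {0..})"
begin

definition g :: "real \<Rightarrow> real" where "g \<xi> = exp (- (c * \<xi>\<^sup>2))"

text \<open>The factor \<open>exp t\<close> cancels the loss term of the equation and matches the
  decay rate under study, so that the total variation hypothesis becomes convergence of
  \<open>D\<close> to 0.\<close>

definition D :: "real \<Rightarrow> real \<Rightarrow> real" where "D \<xi> t = exp t * (r \<xi> t - g \<xi>)"

text \<open>Rotation invariance of the Gaussian: \<open>g\<close> is an equilibrium of the
  equation.\<close>

lemma g_cos_sin: "g (\<xi> * cos \<theta>) * g (\<xi> * sin \<theta>) = g \<xi>"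
proof -
  have "c * (\<xi> * cos \<theta>)\<^sup>2 + c * (\<xi> * sin \<theta>)\<^sup>2 = c * \<xi>\<^sup>2 * ((sin \<theta>)\<^sup>2 + (cos \<theta>)\<^sup>2)"
    by (simp only: power_mult_distrib distrib_left mult.assoc add.commute)
  then show ?thesis
    by (simp add: g_def flip: exp_add)
qed

lemma abs_g_le_1: "\<bar>g \<xi>\<bar> \<le> 1"
  using c_nonneg by (simp add: g_def)

lemma g_cont: "continuous_on S g"
  unfolding g_def[abs_def] by (intro continuous_intros)

lemma abs_1_minus_g_le: "\<bar>1 - g \<xi>\<bar> \<le> c * \<xi>\<^sup>2"
  using abs_g_le_1[of \<xi>] exp_ge_add_one_self[of "- (c * \<xi>\<^sup>2)"] by (simp add: g_def)

lemma D_cont: "0 \<le> t \<Longrightarrow> continuous_on UNIV (\<lambda>\<xi>. D \<xi> t)"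
  unfolding D_def by (intro continuous_intros r_cont g_cont)

lemma cos_sin_comp_cont:
  fixes f :: "real \<Rightarrow> real"
  assumes "continuous_on UNIV f"
  shows "continuous_on UNIV (\<lambda>\<theta>. f (\<xi> * cos \<theta>))" "continuous_on UNIV (\<lambda>\<theta>. f (\<xi> * sin \<theta>))"
  by (intro continuous_on_compose2[OF assms] continuous_intros; simp)+

lemmas flow_cont = cos_sin_comp_cont[OF r_cont] cos_sin_comp_cont[OF D_cont] cos_sin_comp_cont[OF g_cont]

text \<open>From \<open>r * r - g * g = (r - g) * r + g * (r - g)\<close>, the first factors being
  taken at \<open>\<xi> * cos \<theta>\<close> and the second at
  \<open>\<xi> * sin \<theta>\<close>. Both coefficients of \<open>D\<close> are at most 1 in
  absolute value.\<close>

definition D' :: "real \<Rightarrow> real \<Rightarrow> real" where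
  "D' \<xi> t = circle_mean (\<lambda>\<theta>. D (\<xi> * cos \<theta>) t * r (\<xi> * sin \<theta>) t + g (\<xi> * cos \<theta>) * D (\<xi> * sin \<theta>) t)"

lemma D_deriv:
  assumes t: "0 \<le> t"
  shows "((\<lambda>s. D \<xi> s) has_vector_derivative D' \<xi> t) (at t within {0..})"
proof -
  define Q where "Q = circle_mean (\<lambda>\<theta>. r (\<xi> * cos \<theta>) t * r (\<xi> * sin \<theta>) t)"
  have "D' \<xi> t = circle_mean (\<lambda>\<theta>. exp t * (r (\<xi> * cos \<theta>) t * r (\<xi> * sin \<theta>) t - g \<xi>))"
    unfolding D'_def
  proof (rule arg_cong[where f = circle_mean], rule ext)
    fix \<theta>
    show "D (\<xi> * cos \<theta>) t * r (\<xi> * sin \<theta>) t + g (\<xi> * cos \<theta>) * D (\<xi> * sin \<theta>) t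
        = exp t * (r (\<xi> * cos \<theta>) t * r (\<xi> * sin \<theta>) t - g \<xi>)"
      unfolding g_cos_sin[of \<xi> \<theta>, symmetric] by (simp add: D_def algebra_simps)
  qed
  also have "\<dots> = exp t * (Q - g \<xi>)"
    unfolding circle_mean_cmult Q_def
    by (subst circle_mean_diff) (auto intro!: continuous_intros flow_cont t)
  \<comment> \<open>Regrouped to the shape of the product rule: the derivative of
    \<open>exp t\<close> supplies the first summand, that of \<open>r\<close> the second.\<close>
  finally have D': "D' \<xi> t = exp t * (r \<xi> t - g \<xi>) + exp t * (Q - r \<xi> t)"
    by (simp add: algebra_simps)
  show ?thesis
    using r_deriv[OF t, of \<xi>] unfolding D' Q_def[symmetric] D_def[abs_def]
      has_real_derivative_iff_has_vector_derivative[symmetric]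
    by (auto intro!: derivative_eq_intros)
qed

lemma abs_D_le:
  assumes "0 \<le> t" "t \<le> T"
  shows "\<bar>D \<xi> t\<bar> \<le> 2 * exp T"
proof -
  have "\<bar>r \<xi> t - g \<xi>\<bar> \<le> 2"
    using abs_r_le_1[OF assms(1), of \<xi>] abs_g_le_1[of \<xi>] by linarith
  then have "exp t * \<bar>r \<xi> t - g \<xi>\<bar> \<le> exp T * 2"
    using assms by (intro mult_mono) auto
  then show ?thesis
    by (simp add: D_def abs_mult mult.commute)
qed

lemma abs_D'_integrand_le:
  assumes "0 \<le> t"
  shows "\<bar>x * r \<xi> t + g \<eta> * y\<bar> \<le> \<bar>x\<bar> + \<bar>y\<bar>"
proof -
  have "\<bar>x * r \<xi> t\<bar> \<le> \<bar>x\<bar>" "\<bar>g \<eta> * y\<bar> \<le> \<bar>y\<bar>"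
    using abs_r_le_1[OF assms, of \<xi>] abs_g_le_1[of \<eta>]
    by (simp_all add: abs_mult mult_left_le mult_left_le_one_le)
  then show ?thesis
    by linarith
qed

text \<open>Since the coefficients \<open>r\<close> and \<open>g\<close> are bounded by 1, the order
  of vanishing at \<open>\<xi> = 0\<close> persists in time, and the constant grows no faster than
  under the linearised gain operator.\<close>

lemma D_growth:
  assumes init: "\<And>\<xi>. \<bar>D \<xi> 0\<bar> \<le> A * \<xi> ^ (2 * p)" and t: "0 \<le> t"
  shows "\<bar>D \<xi> t\<bar> \<le> A * exp (collision_eigenvalue p * t) * \<xi> ^ (2 * p)"
\<comment> \<open>With \<open>q = 0\<close> the crude weight equals 2, so \<open>B = exp t\<close>
  is exactly the bound \<open>2 * exp t\<close> on \<open>D\<close>.\<close>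
proof (rule weighted_gronwall[where T = t and u = D and u' = D' and K = 0 and B = "exp t" and q = 0])
  show "\<bar>D' \<xi> s\<bar> \<le> circle_mean (\<lambda>\<theta>. \<bar>D (\<xi> * cos \<theta>) s\<bar> + \<bar>D (\<xi> * sin \<theta>) s\<bar>)
      + 0 * exp (collision_eigenvalue p * s) * \<xi> ^ (2 * p)" if "0 \<le> s" for \<xi> s
    unfolding D'_def mult_zero_left add_0_right
    by (intro abs_circle_mean_le abs_D'_integrand_le continuous_intros flow_cont that)
  show "0 \<le> A"
    using init[of 1] by simp
qed (use D_cont D_deriv abs_D_le[of _ t] init t in \<open>auto simp: mult_ac\<close>)

text \<open>With the coefficients \<open>r\<close> and \<open>g\<close> replaced by 1, the leading
  term would evolve exactly as \<open>a * exp (k * t) * \<xi> ^ (2 * m)\<close>, where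
  \<open>k\<close> is its eigenvalue. The replacement costs a factor
  \<open>L * \<xi>\<^sup>2\<close>, hence acts at the next even order, whose eigenvalue is smaller.
  So the deviation also grows at most like \<open>exp (k * t)\<close>; after rescaling, the limit
  leaves an inequality between powers of \<open>\<xi>\<close> that fails near 0 unless
  \<open>a = 0\<close>.\<close>

lemma leading_coefficient_eq_0:
  assumes init: "\<And>\<xi>. \<bar>D \<xi> 0 - a * \<xi> ^ (2 * m)\<bar> \<le> N * \<xi> ^ (2 * Suc m)"
    and L: "\<And>\<xi> t. 0 \<le> t \<Longrightarrow> \<bar>1 - r \<xi> t\<bar> \<le> L * \<xi>\<^sup>2" "\<And>\<xi>. \<bar>1 - g \<xi>\<bar> \<le> L * \<xi>\<^sup>2"
    and lim: "\<And>\<xi>. ((\<lambda>t. exp (- (collision_eigenvalue m * t)) * D \<xi> t) \<longlongrightarrow> 0) at_top"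
  shows "a = 0"
proof -
  define k where "k = collision_eigenvalue m"
  define K where "K = 2 * \<bar>a\<bar> * L"
  \<comment> \<open>The eigenvalue gap \<open>\<delta>\<close> absorbs the source term:
    \<open>A\<close> is chosen with \<open>\<delta> * A \<ge> K\<close>, as the growth estimate
    demands, and with \<open>A \<ge> N\<close>, as the initial bound demands.\<close>
  define \<delta> where "\<delta> = k - collision_eigenvalue (Suc m)"
  define A where "A = N + K / \<delta>"
  define f where "f = (\<lambda>\<xi> t. D \<xi> t - a * exp (k * t) * \<xi> ^ (2 * m))"
  define f' where "f' = (\<lambda>\<xi> t. D' \<xi> t - a * (k * exp (k * t)) * \<xi> ^ (2 * m))"
  have \<delta>: "0 < \<delta>"
    using collision_eigenvalue_Suc_less[of m] by (simp add: \<delta>_def k_def)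
  have "0 \<le> N"
    using init[of 1] by simp
  have L_nonneg: "0 \<le> L"
    using L(2)[of 1] by simp
  then have "0 \<le> K"
    by (simp add: K_def)
  have A: "N \<le> A" "0 \<le> A" "collision_eigenvalue (Suc m) * A + K \<le> k * A"
  proof -
    show "N \<le> A" "0 \<le> A"
      using \<open>0 \<le> N\<close> \<open>0 \<le> K\<close> \<delta> by (simp_all add: A_def)
    have "K \<le> \<delta> * A"
      using \<open>0 \<le> N\<close> \<delta> by (simp add: A_def distrib_left)
    then show "collision_eigenvalue (Suc m) * A + K \<le> k * A"
      by (simp add: \<delta>_def algebra_simps)
  qed
  have f_cont: "continuous_on UNIV (\<lambda>\<xi>. f \<xi> t)" if "0 \<le> t" for t
    unfolding f_def by (intro continuous_intros D_cont that)
  have f_deriv: "((\<lambda>s. f \<xi> s) has_vector_derivative f' \<xi> t) (at t within {0..})" if "0 \<le> t" for \<xi> t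
    using D_deriv[OF that, of \<xi>]
    unfolding f_def f'_def has_real_derivative_iff_has_vector_derivative[symmetric]
    by (auto intro!: derivative_eq_intros)
  have f'_bound: "\<bar>f' \<xi> t\<bar> \<le> circle_mean (\<lambda>\<theta>. \<bar>f (\<xi> * cos \<theta>) t\<bar> + \<bar>f (\<xi> * sin \<theta>) t\<bar>)
      + K * exp (k * t) * \<xi> ^ (2 * Suc m)" if t: "0 \<le> t" for \<xi> t
  proof -
    define e where "e = a * exp (k * t) * \<xi> ^ (2 * m)"
    define h where "h = (\<lambda>\<theta>. D (\<xi> * cos \<theta>) t * r (\<xi> * sin \<theta>) t + g (\<xi> * cos \<theta>) * D (\<xi> * sin \<theta>) t
      - e * (cos \<theta> ^ (2 * m) + sin \<theta> ^ (2 * m)))"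
    have "f' \<xi> t = circle_mean h"
      unfolding f'_def D'_def h_def
      by (subst circle_mean_diff)
        (auto intro!: continuous_intros flow_cont t simp: collision_eigenvalue_def[symmetric] k_def[symmetric] e_def)
    also have "\<bar>\<dots>\<bar> \<le> circle_mean (\<lambda>\<theta>. (\<bar>f (\<xi> * cos \<theta>) t\<bar> + \<bar>f (\<xi> * sin \<theta>) t\<bar>)
      + K * exp (k * t) * \<xi> ^ (2 * Suc m))"
    proof (rule abs_circle_mean_le)
      show "continuous_on UNIV h"
        unfolding h_def by (intro continuous_intros flow_cont t)
      show "continuous_on UNIV (\<lambda>\<theta>. (\<bar>f (\<xi> * cos \<theta>) t\<bar> + \<bar>f (\<xi> * sin \<theta>) t\<bar>)
          + K * exp (k * t) * \<xi> ^ (2 * Suc m))"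
        by (intro continuous_intros cos_sin_comp_cont f_cont t)
      show "\<bar>h \<theta>\<bar> \<le> (\<bar>f (\<xi> * cos \<theta>) t\<bar> + \<bar>f (\<xi> * sin \<theta>) t\<bar>) + K * exp (k * t) * \<xi> ^ (2 * Suc m)" for \<theta>
      proof -
        \<comment> \<open>The cost of replacing one coefficient by 1: \<open>z\<close> stands for
          \<open>1 - r\<close> or \<open>1 - g\<close> at \<open>\<xi> * y\<close>, while
          \<open>x\<close> is the other coordinate on the circle.\<close>
        have remainder: "\<bar>e * (x ^ (2 * m) * z)\<bar> \<le> \<bar>a\<bar> * L * exp (k * t) * \<xi> ^ (2 * Suc m)"
          if "\<bar>x\<bar> \<le> 1" "\<bar>y\<bar> \<le> 1" "\<bar>z\<bar> \<le> L * (\<xi> * y)\<^sup>2" for x y z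
        proof -
          have "(\<xi> * y)\<^sup>2 \<le> \<xi>\<^sup>2"
            using even_power_le_1[OF that(2), of 1] by (simp add: power_mult_distrib mult_left_le)
          then have "\<bar>z\<bar> \<le> L * \<xi>\<^sup>2"
            using that(3) L_nonneg by (meson mult_left_mono order_trans)
          moreover have "\<bar>x ^ (2 * m)\<bar> \<le> 1"
            using even_power_le_1[OF that(1), of m] by simp
          ultimately have "\<bar>e\<bar> * (\<bar>x ^ (2 * m)\<bar> * \<bar>z\<bar>) \<le> \<bar>e\<bar> * (1 * (L * \<xi>\<^sup>2))"
            by (intro mult_left_mono mult_mono) auto
          moreover have "\<bar>\<xi> ^ (2 * m)\<bar> = \<xi> ^ (2 * m)"
            by simp
          ultimately show ?thesis
            by (simp only: e_def abs_mult) (simp add: power_add power2_eq_square mult_ac)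
        qed
        let ?c = "\<xi> * cos \<theta>" and ?s = "\<xi> * sin \<theta>"
        \<comment> \<open>Splitting \<open>D\<close> into \<open>f\<close> and the leading term
          isolates the defects \<open>1 - r\<close> and \<open>1 - g\<close>, each multiplied by the
          leading term. These two account for the 2 in \<open>K\<close>.\<close>
        have "h \<theta> = (f ?c t * r ?s t + g ?c * f ?s t)
            - e * (cos \<theta> ^ (2 * m) * (1 - r ?s t)) - e * (sin \<theta> ^ (2 * m) * (1 - g ?c))"
          by (simp add: h_def f_def e_def power_mult_distrib algebra_simps)
        moreover have "\<bar>f ?c t * r ?s t + g ?c * f ?s t\<bar> \<le> \<bar>f ?c t\<bar> + \<bar>f ?s t\<bar>"
          by (rule abs_D'_integrand_le[OF t])
        moreover have "\<bar>e * (cos \<theta> ^ (2 * m) * (1 - r ?s t))\<bar> \<le> \<bar>a\<bar> * L * exp (k * t) * \<xi> ^ (2 * Suc m)"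
          "\<bar>e * (sin \<theta> ^ (2 * m) * (1 - g ?c))\<bar> \<le> \<bar>a\<bar> * L * exp (k * t) * \<xi> ^ (2 * Suc m)"
          by (intro remainder[where y = "sin \<theta>"] remainder[where y = "cos \<theta>"] L(1)[OF t] L(2); simp)+
        moreover have "K * exp (k * t) * \<xi> ^ (2 * Suc m) = 2 * (\<bar>a\<bar> * L * exp (k * t) * \<xi> ^ (2 * Suc m))"
          by (simp add: K_def)
        ultimately show ?thesis
          by linarith
      qed
    qed
    also have "\<dots> = circle_mean (\<lambda>\<theta>. \<bar>f (\<xi> * cos \<theta>) t\<bar> + \<bar>f (\<xi> * sin \<theta>) t\<bar>)
      + K * exp (k * t) * \<xi> ^ (2 * Suc m)"
      by (subst circle_mean_add) (auto intro!: continuous_intros cos_sin_comp_cont f_cont t)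
    finally show ?thesis .
  qed
  have f_le: "\<bar>f \<xi> t\<bar> \<le> A * exp (k * t) * \<xi> ^ (2 * Suc m)" if t: "0 \<le> t" for \<xi> t
  \<comment> \<open>Subtracting the leading term makes the crude bound grow like
    \<open>\<xi> ^ (2 * m)\<close>, hence \<open>q = m\<close>.\<close>
  proof (rule weighted_gronwall[where T = t and u = f and u' = f' and K = K and q = m
        and B = "2 * exp t + \<bar>a\<bar> * exp (k * t)"])
    show "\<bar>f \<xi> s\<bar> \<le> (2 * exp t + \<bar>a\<bar> * exp (k * t)) * (1 + \<xi> ^ (2 * m))" if s: "0 \<le> s" "s \<le> t" for \<xi> s
    proof -
      have "\<bar>a\<bar> * (exp (k * s) * \<xi> ^ (2 * m)) \<le> \<bar>a\<bar> * (exp (k * t) * \<xi> ^ (2 * m))"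
        using s collision_eigenvalue_pos[of m] by (intro mult_left_mono mult_right_mono) (auto simp: k_def)
      moreover have "\<bar>f \<xi> s\<bar> \<le> \<bar>D \<xi> s\<bar> + \<bar>a\<bar> * (exp (k * s) * \<xi> ^ (2 * m))"
        using abs_triangle_ineq4[of "D \<xi> s" "a * exp (k * s) * \<xi> ^ (2 * m)"]
        by (simp add: f_def abs_mult mult.assoc)
      moreover have "0 \<le> exp t * \<xi> ^ (2 * m)" "0 \<le> \<bar>a\<bar> * exp (k * t)"
        by simp_all
      moreover have "(2 * exp t + \<bar>a\<bar> * exp (k * t)) * (1 + \<xi> ^ (2 * m)) = 2 * exp t + \<bar>a\<bar> * exp (k * t)
          + 2 * (exp t * \<xi> ^ (2 * m)) + \<bar>a\<bar> * (exp (k * t) * \<xi> ^ (2 * m))"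
        by (simp add: algebra_simps)
      ultimately show ?thesis
        using abs_D_le[OF s, of \<xi>] by linarith
    qed
    show "\<bar>f \<xi> 0\<bar> \<le> A * \<xi> ^ (2 * Suc m)" for \<xi>
    proof -
      have "N * \<xi> ^ (2 * Suc m) \<le> A * \<xi> ^ (2 * Suc m)"
        by (intro mult_right_mono A zero_le_even_power) auto
      then show ?thesis
        using init[of \<xi>] by (simp add: f_def)
    qed
  qed (use f_cont f_deriv f'_bound A t in auto)
  \<comment> \<open>Divide the bound on \<open>f\<close> by \<open>exp (k * t)\<close> and let
    \<open>t\<close> grow: the contribution of \<open>D\<close> disappears.\<close>
  have a_le: "\<bar>a\<bar> * \<xi> ^ (2 * m) \<le> A * \<xi> ^ (2 * Suc m)" for \<xi>
  proof (rule tendsto_upperbound)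
    show "((\<lambda>t. \<bar>exp (- (k * t)) * D \<xi> t - a * \<xi> ^ (2 * m)\<bar>) \<longlongrightarrow> \<bar>a\<bar> * \<xi> ^ (2 * m)) at_top"
      using tendsto_rabs[OF tendsto_diff[OF lim[of \<xi>] tendsto_const[of "a * \<xi> ^ (2 * m)"]]]
      by (simp add: k_def abs_mult)
    show "\<forall>\<^sub>F t in at_top. \<bar>exp (- (k * t)) * D \<xi> t - a * \<xi> ^ (2 * m)\<bar> \<le> A * \<xi> ^ (2 * Suc m)"
    proof (rule eventually_mono[OF eventually_ge_at_top[of 0]])
      fix t :: real assume t: "0 \<le> t"
      have "exp (- (k * t)) * \<bar>f \<xi> t\<bar> \<le> exp (- (k * t)) * (A * exp (k * t) * \<xi> ^ (2 * Suc m))"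
        by (intro mult_left_mono f_le t) simp
      also have "\<dots> = (exp (- (k * t)) * exp (k * t)) * (A * \<xi> ^ (2 * Suc m))"
        by (simp only: mult_ac)
      also have "\<dots> = A * \<xi> ^ (2 * Suc m)"
        by (simp flip: exp_add)
      also have "exp (- (k * t)) * \<bar>f \<xi> t\<bar> = \<bar>exp (- (k * t)) * f \<xi> t\<bar>"
        by (simp add: abs_mult)
      also have "exp (- (k * t)) * f \<xi> t = exp (- (k * t)) * D \<xi> t - (exp (- (k * t)) * exp (k * t)) * (a * \<xi> ^ (2 * m))"
        by (simp add: f_def algebra_simps)
      also have "\<dots> = exp (- (k * t)) * D \<xi> t - a * \<xi> ^ (2 * m)"
        by (simp flip: exp_add)
      finally show "\<bar>exp (- (k * t)) * D \<xi> t - a * \<xi> ^ (2 * m)\<bar> \<le> A * \<xi> ^ (2 * Suc m)" .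
    qed
  qed simp
  show "a = 0"
  proof (rule ccontr)
    assume "a \<noteq> 0"
    \<comment> \<open>Chosen so that \<open>A * \<xi>\<^sup>2 < \<bar>a\<bar>\<close>; adding 1
      keeps the denominator positive when \<open>A = 0\<close>.\<close>
    define \<xi> where "\<xi> = sqrt (\<bar>a\<bar> / (2 * (A + 1)))"
    have sq: "\<xi>\<^sup>2 = \<bar>a\<bar> / (2 * (A + 1))" and "\<xi> > 0"
      using \<open>0 \<le> A\<close> \<open>a \<noteq> 0\<close> by (simp_all add: \<xi>_def)
    have "\<bar>a\<bar> * \<xi> ^ (2 * m) \<le> (A * \<xi>\<^sup>2) * \<xi> ^ (2 * m)"
      using a_le[of \<xi>] by (simp add: power_add power2_eq_square mult_ac)
    then have "\<bar>a\<bar> \<le> A * \<xi>\<^sup>2"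
      using \<open>\<xi> > 0\<close> by simp
    also have "\<dots> < \<bar>a\<bar>"
      unfolding sq using \<open>0 \<le> A\<close> \<open>a \<noteq> 0\<close> by (simp add: field_simps add_strict_increasing2)
    finally show False
      by simp
  qed
qed

text \<open>Strong induction: once all earlier coefficients vanish, \<open>d m\<close> is the
  leading one.\<close>

lemma Taylor_coefficient_eq_0:
  assumes Taylor: "\<And>n \<xi>. \<bar>D \<xi> 0 - (\<Sum>k<n. d k * \<xi> ^ (2 * k))\<bar> \<le> N n * \<xi> ^ (2 * n)"
    and d_0: "d 0 = 0"
    and lim: "\<And>\<xi>. ((\<lambda>t. D \<xi> t) \<longlongrightarrow> 0) at_top"
  shows "d m = 0"
proof (induction m rule: less_induct)
  case (less m)
  \<comment> \<open>The eigenvalue of index 1 equals 1, so the growth of \<open>D\<close> is exactly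
    offset by its factor \<open>exp t\<close>, and the quadratic bound is uniform in time.\<close>
  have r_g: "\<bar>r \<xi> t - g \<xi>\<bar> \<le> N 1 * \<xi>\<^sup>2" if "0 \<le> t" for \<xi> t
  proof -
    have "\<bar>D \<xi> t\<bar> \<le> N 1 * exp (collision_eigenvalue 1 * t) * \<xi> ^ (2 * 1)"
      using Taylor[of _ 1] d_0 that by (intro D_growth) auto
    then have "exp t * \<bar>r \<xi> t - g \<xi>\<bar> \<le> exp t * (N 1 * \<xi>\<^sup>2)"
      by (simp only: D_def abs_mult collision_eigenvalue_1) (simp add: mult_ac)
    then show ?thesis
      by simp
  qed
  have N_nonneg: "0 \<le> N 1"
    using r_g[of 0 1] by simp
  show ?case
  proof (rule leading_coefficient_eq_0)
    show "\<bar>D \<xi> 0 - d m * \<xi> ^ (2 * m)\<bar> \<le> N (Suc m) * \<xi> ^ (2 * Suc m)" for \<xi>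
    proof -
      have "(\<Sum>k<Suc m. d k * \<xi> ^ (2 * k)) = d m * \<xi> ^ (2 * m)"
        by (simp add: less.IH)
      then show ?thesis
        using Taylor[of \<xi> "Suc m"] by simp
    qed
    show "\<bar>1 - r \<xi> t\<bar> \<le> (c + N 1) * \<xi>\<^sup>2" if "0 \<le> t" for \<xi> t
      using r_g[OF that, of \<xi>] abs_1_minus_g_le[of \<xi>] by (simp add: distrib_right)
    show "\<bar>1 - g \<xi>\<bar> \<le> (c + N 1) * \<xi>\<^sup>2" for \<xi>
      using abs_1_minus_g_le[of \<xi>] N_nonneg by (simp add: distrib_right add_increasing2)
    show "((\<lambda>t. exp (- (collision_eigenvalue m * t)) * D \<xi> t) \<longlongrightarrow> 0) at_top" for \<xi>
    proof (rule Lim_null_comparison)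
      show "((\<lambda>t. \<bar>D \<xi> t\<bar>) \<longlongrightarrow> 0) at_top"
        using tendsto_rabs_zero[OF lim] .
      show "\<forall>\<^sub>F t in at_top. norm (exp (- (collision_eigenvalue m * t)) * D \<xi> t) \<le> \<bar>D \<xi> t\<bar>"
        using collision_eigenvalue_pos[of m]
        by (intro eventually_mono[OF eventually_ge_at_top[of 0]]) (simp add: abs_mult mult_left_le_one_le)
    qed
  qed
qed

text \<open>Uniqueness for the Gaussian datum: the growth bound with constant 0.\<close>

lemma r_eq_g:
  assumes "\<And>\<xi>. r \<xi> 0 = g \<xi>" "0 \<le> t"
  shows "r \<xi> t = g \<xi>"
  using D_growth[of 0 0 t \<xi>] assms by (simp add: D_def)

end

section \<open>Total variation and characteristic functions\<close>

text \<open>Layer-cake argument: up to \<open>1 / N\<close>, \<open>f\<close> is the average of the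
  indicators of its superlevel sets at heights \<open>k / N\<close>, and on each of these sets the
  two measures differ by at most the total variation distance.\<close>

lemma abs_integral_diff_le_tv_dist:
  fixes f :: "real \<Rightarrow> real"
  assumes P: "real_distribution P" and Q: "real_distribution Q"
    and f [measurable]: "f \<in> borel_measurable borel" and f01: "\<And>x. 0 \<le> f x" "\<And>x. f x \<le> 1"
  shows "\<bar>(LINT x|P. f x) - (LINT x|Q. f x)\<bar> \<le> tv_dist P Q"
proof -
  interpret P: real_distribution P by (rule P)
  interpret Q: real_distribution Q by (rule Q)
  have tv: "\<bar>measure P B - measure Q B\<bar> \<le> tv_dist P Q" if "B \<in> sets borel" for B
    unfolding tv_dist_def
  proof (rule cSUP_upper[OF that])
    have "\<bar>measure P B - measure Q B\<bar> \<le> 1" for B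
      using P.prob_le_1[of B] Q.prob_le_1[of B] measure_nonneg[of P B] measure_nonneg[of Q B] by linarith
    then show "bdd_above ((\<lambda>B. \<bar>measure P B - measure Q B\<bar>) ` sets borel)"
      by (intro bdd_aboveI2[where M = 1])
  qed
  have approx: "\<bar>(LINT x|P. f x) - (LINT x|Q. f x)\<bar> \<le> tv_dist P Q + 2 * (1 / real (Suc n))" for n
  proof -
    define N where "N = Suc n"
    define S where "S = (\<lambda>k. {x. real k \<le> real N * f x})"
    define h where "h = (\<lambda>x. (\<Sum>k=1..N. indicat_real (S k) x) / real N)"
    have S [measurable]: "S k \<in> sets borel" for k
      unfolding S_def by measurable
    have h_meas [measurable]: "h \<in> borel_measurable borel"
      unfolding h_def by measurable
    have h: "h x \<le> f x" "f x \<le> h x + 1 / real N" for x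
    proof -
      have le_N: "real N * f x \<le> real N"
        using f01[of x] by (simp add: mult_left_le)
      \<comment> \<open>The sets containing \<open>x\<close> are counted by the integer part of
        \<open>N * f x\<close>, and \<open>f x \<le> 1\<close> keeps this count within
        \<open>N\<close>.\<close>
      have "{k \<in> {1..N}. x \<in> S k} = {1..nat \<lfloor>real N * f x\<rfloor>}"
        using le_N f01(1)[of x] by (auto simp: S_def le_nat_floor le_nat_iff le_floor_iff)
      then have "(\<Sum>k=1..N. indicat_real (S k) x) = real (nat \<lfloor>real N * f x\<rfloor>)"
        by (simp add: indicator_def sum.If_cases Int_def)
      moreover have "0 \<le> real N * f x"
        using f01[of x] by simp
      then have "real (nat \<lfloor>real N * f x\<rfloor>) \<le> real N * f x" "real N * f x \<le> real (nat \<lfloor>real N * f x\<rfloor>) + 1"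
        by linarith+
      moreover have "0 < real N"
        by (simp add: N_def)
      ultimately show "h x \<le> f x" "f x \<le> h x + 1 / real N"
        by (simp_all add: h_def field_simps)
    qed
    have int: "integrable M f" "integrable M h" "(LINT x|M. h x) \<le> (LINT x|M. f x)"
      "(LINT x|M. f x) \<le> (LINT x|M. h x) + 1 / real N"
      "(LINT x|M. h x) = (\<Sum>k=1..N. measure M (S k)) / real N" if M: "real_distribution M" for M
    proof -
      interpret M: real_distribution M by (rule M)
      show f_int: "integrable M f"
        by (rule M.integrable_const_bound[where B = 1]) (use f01 in auto)
      show h_int: "integrable M h"
        unfolding h_def by (auto intro!: integrable_real_indicator simp: M.emeasure_finite less_top[symmetric])
      show "(LINT x|M. h x) \<le> (LINT x|M. f x)"
        by (intro integral_mono h f_int h_int)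
      have "(LINT x|M. f x) \<le> (LINT x|M. h x + 1 / real N)"
        by (intro integral_mono h f_int Bochner_Integration.integrable_add h_int) auto
      then show "(LINT x|M. f x) \<le> (LINT x|M. h x) + 1 / real N"
        using M.prob_space by (subst (asm) Bochner_Integration.integral_add) (auto simp: h_int)
      show "(LINT x|M. h x) = (\<Sum>k=1..N. measure M (S k)) / real N"
        unfolding h_def by (simp add: Bochner_Integration.integral_sum M.emeasure_finite less_top[symmetric])
    qed
    have "\<bar>(LINT x|P. h x) - (LINT x|Q. h x)\<bar> = \<bar>\<Sum>k=1..N. measure P (S k) - measure Q (S k)\<bar> / real N"
      by (simp add: int(5)[OF P] int(5)[OF Q] sum_subtractf abs_div flip: diff_divide_distrib)
    also have "\<dots> \<le> (\<Sum>k=1..N. tv_dist P Q) / real N"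
      by (intro divide_right_mono order_trans[OF sum_abs] sum_mono tv S) simp
    also have "\<dots> = tv_dist P Q"
      by (simp add: N_def)
    finally show ?thesis
      using int(3,4)[OF P] int(3,4)[OF Q] by (simp add: N_def)
  qed
  have "(\<lambda>n. tv_dist P Q + 2 * (1 / real (Suc n))) \<longlonglongrightarrow> tv_dist P Q + 2 * 0"
    by (intro tendsto_intros LIMSEQ_Suc[OF lim_1_over_n])
  then show ?thesis
    using approx by (intro LIMSEQ_le_const[of _ "tv_dist P Q"]) auto
qed

lemma (in real_distribution)
  shows Re_char: "Re (char M \<xi>) = (LINT x|M. cos (\<xi> * x))"
    and Im_char: "Im (char M \<xi>) = (LINT x|M. sin (\<xi> * x))"
proof -
  have "integrable M (\<lambda>x. iexp (\<xi> * x))"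
    by (intro integrable_iexp) auto
  then show "Re (char M \<xi>) = (LINT x|M. cos (\<xi> * x))" "Im (char M \<xi>) = (LINT x|M. sin (\<xi> * x))"
    unfolding char_def by (simp_all flip: integral_Re integral_Im add: Re_exp Im_exp)
qed

text \<open>Rescaling by \<open>(1 + f x) / 2\<close> into the unit interval costs the factor
  2.\<close>

lemma abs_integral_diff_le_2_tv_dist:
  fixes f :: "real \<Rightarrow> real"
  assumes P: "real_distribution P" and Q: "real_distribution Q"
    and f [measurable]: "f \<in> borel_measurable borel" and f1: "\<And>x. \<bar>f x\<bar> \<le> 1"
  shows "\<bar>(LINT x|P. f x) - (LINT x|Q. f x)\<bar> \<le> 2 * tv_dist P Q"
proof -
  have int: "(LINT x|M. (1 + f x) / 2) = (1 + (LINT x|M. f x)) / 2" if M: "real_distribution M" for M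
  proof -
    interpret M: real_distribution M by (rule M)
    have "integrable M f"
      by (rule M.integrable_const_bound[where B = 1]) (use f1 in auto)
    moreover have "M.prob UNIV = 1"
      using M.prob_space by simp
    ultimately show ?thesis
      by simp
  qed
  have "0 \<le> (1 + f x) / 2 \<and> (1 + f x) / 2 \<le> 1" for x
    using f1[of x] by (simp add: abs_le_iff)
  then have "\<bar>(LINT x|P. (1 + f x) / 2) - (LINT x|Q. (1 + f x) / 2)\<bar> \<le> tv_dist P Q"
    by (intro abs_integral_diff_le_tv_dist P Q) auto
  then show ?thesis
    unfolding int[OF P] int[OF Q] by (simp add: abs_le_iff field_simps)
qed

lemma Re_Im_char_diff_le_tv_dist:
  assumes P: "real_distribution P" and Q: "real_distribution Q"
  shows "\<bar>Re (char P \<xi>) - Re (char Q \<xi>)\<bar> \<le> 2 * tv_dist P Q"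
    and "\<bar>Im (char P \<xi>) - Im (char Q \<xi>)\<bar> \<le> 2 * tv_dist P Q"
  unfolding real_distribution.Re_char[OF P] real_distribution.Re_char[OF Q]
    real_distribution.Im_char[OF P] real_distribution.Im_char[OF Q]
  by (intro abs_integral_diff_le_2_tv_dist P Q; simp)+

section \<open>The Gaussian law\<close>

text \<open>Scaling a standard normal variable covers zero, positive and negative
  \<open>\<sigma>\<close> at once, so the later facts need no case distinction.\<close>

lemma gaussian_eq_distr: "gaussian \<sigma> = distr std_normal_distribution borel (\<lambda>x. \<sigma> * x)"
proof (cases "\<sigma> = 0")
  case True
  interpret real_distribution std_normal_distribution
    by (rule real_dist_normal_dist)
  show ?thesis
    using True by (simp add: gaussian_def distr_const)
next
  case False
  interpret prob_space std_normal_distribution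
    using real_dist_normal_dist by (simp add: real_distribution_def)
  have "distributed std_normal_distribution lborel (\<lambda>x. x) (normal_density 0 1)"
    by (simp add: distributed_def distr_id2)
  from normal_density_affine[OF this, of \<sigma> 0] False
  have "distr std_normal_distribution lborel (\<lambda>x. \<sigma> * x) = density lborel (normal_density 0 \<bar>\<sigma>\<bar>)"
    by (simp add: distributed_def)
  moreover have "normal_density 0 \<bar>\<sigma>\<bar> = normal_density 0 \<sigma>"
    by (simp add: normal_density_def fun_eq_iff)
  moreover have "distr std_normal_distribution lborel (\<lambda>x. \<sigma> * x) = distr std_normal_distribution borel (\<lambda>x. \<sigma> * x)"
    by (intro distr_cong) auto
  ultimately show ?thesis
    using False by (simp add: gaussian_def)
qed

lemma real_distribution_gaussian: "real_distribution (gaussian \<sigma>)"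
proof -
  interpret real_distribution std_normal_distribution
    by (rule real_dist_normal_dist)
  show ?thesis
    unfolding gaussian_eq_distr by (intro real_distribution_distr) simp
qed

lemma char_gaussian: "char (gaussian \<sigma>) \<xi> = complex_of_real (exp (- (\<sigma>\<^sup>2 / 2 * \<xi>\<^sup>2)))"
proof -
  have "char (gaussian \<sigma>) \<xi> = char std_normal_distribution (\<sigma> * \<xi>)"
    unfolding gaussian_eq_distr char_def by (subst integral_distr) (auto simp: mult_ac)
  then show ?thesis
    by (simp add: char_std_normal_distribution power_mult_distrib)
qed

section \<open>The collision integral of characteristic functions\<close>

lemma wild_convolution_eq_integral:
  assumes "continuous_on UNIV f" "continuous_on UNIV h"
  shows "wild_convolution f h \<xi> =
    (1 / (2 * pi)) *\<^sub>R integral {0..2 * pi} (\<lambda>\<theta>. f (\<xi> * cos \<theta>) * h (\<xi> * sin \<theta>))"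
proof -
  have "continuous_on {0..2 * pi} (\<lambda>\<theta>. f (\<xi> * cos \<theta>) * h (\<xi> * sin \<theta>))"
    by (intro continuous_intros continuous_on_compose2[OF assms(1)] continuous_on_compose2[OF assms(2)]) auto
  then show ?thesis
    unfolding wild_convolution_def
    by (subst set_borel_integral_eq_integral(2)) (auto intro!: borel_integrable_atLeastAtMost')
qed

lemma wild_convolution_of_real:
  assumes "continuous_on UNIV f"
  shows "wild_convolution (\<lambda>\<eta>. complex_of_real (f \<eta>)) (\<lambda>\<eta>. complex_of_real (f \<eta>)) \<xi> =
    complex_of_real (circle_mean (\<lambda>\<theta>. f (\<xi> * cos \<theta>) * f (\<xi> * sin \<theta>)))"
proof -
  have "continuous_on {0..2 * pi} (\<lambda>\<theta>. f (\<xi> * cos \<theta>) * f (\<xi> * sin \<theta>))"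
    by (intro continuous_intros continuous_on_compose2[OF assms]) auto
  from integral_linear[OF integrable_continuous_real[OF this] bounded_linear_of_real[where 'a = complex]]
  show ?thesis
    by (subst wild_convolution_eq_integral)
      (auto intro!: continuous_intros assms simp: circle_mean_def o_def scaleR_conv_of_real)
qed

text \<open>The rotation \<open>\<theta> \<mapsto> \<theta> + pi\<close> replaces the integrand by its complex conjugate.\<close>

lemma Im_wild_convolution_eq_0:
  assumes f: "continuous_on UNIV f" and f_cnj: "\<And>x. f (- x) = cnj (f x)"
  shows "Im (wild_convolution f f \<xi>) = 0"
proof -
  define F where "F = (\<lambda>\<theta>. f (\<xi> * cos \<theta>) * f (\<xi> * sin \<theta>))"
  have F: "continuous_on S F" for S
    unfolding F_def by (intro continuous_intros continuous_on_compose2[OF f]) auto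
  have "integral {pi..2 * pi} F = integral {0..pi} (F \<circ> (+) pi)"
    using integral_shift_Icc_real[of 0 pi F pi] by simp
  also have "F \<circ> (+) pi = (\<lambda>\<theta>. cnj (F \<theta>))"
    by (simp add: F_def fun_eq_iff f_cnj add.commute[of pi])
  also have "integral {0..pi} (\<lambda>\<theta>. cnj (F \<theta>)) = cnj (integral {0..pi} F)"
    by (simp add: integral_cnj)
  finally have "integral {0..2 * pi} F = integral {0..pi} F + cnj (integral {0..pi} F)"
    using Henstock_Kurzweil_Integration.integral_combine[of 0 pi "2 * pi" F]
    by (simp add: integrable_continuous_real F)
  then show ?thesis
    unfolding wild_convolution_eq_integral[OF f f] F_def by simp
qed

section \<open>Taylor bounds\<close>

text \<open>Lagrange remainder at order \<open>2 * n\<close>: the odd coefficients vanish, and the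
  even power in the remainder is nonnegative.\<close>

lemma cos_even_Taylor_bound:
  fixes x :: real
  shows "\<bar>cos x - (\<Sum>k<n. (-1) ^ k * x ^ (2 * k) / fact (2 * k))\<bar> \<le> x ^ (2 * n) / fact (2 * n)"
proof -
  have sum: "(\<Sum>m<2 * n. cos_coeff m * x ^ m) = (\<Sum>k<n. (-1) ^ k * x ^ (2 * k) / fact (2 * k))" for n
    by (induction n) (simp_all add: cos_coeff_def)
  obtain t where "cos x = (\<Sum>m<2 * n. cos_coeff m * x ^ m)
      + (cos (t + 1/2 * real (2 * n) * pi) / fact (2 * n)) * x ^ (2 * n)"
    using Maclaurin_cos_expansion[of x "2 * n"] by blast
  then have "\<bar>cos x - (\<Sum>k<n. (-1) ^ k * x ^ (2 * k) / fact (2 * k))\<bar>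
      = \<bar>cos (t + 1/2 * real (2 * n) * pi)\<bar> * (x ^ (2 * n) / fact (2 * n))"
    unfolding sum by (simp add: abs_mult)
  also have "\<dots> \<le> x ^ (2 * n) / fact (2 * n)"
    by (intro mult_left_le_one_le) auto
  finally show ?thesis .
qed

text \<open>Lagrange remainder at a positive intermediate point, where
  \<open>exp (- t) \<le> 1\<close>. The cases \<open>n = 0\<close> and \<open>y = 0\<close>, outside
  the scope of \<open>Maclaurin\<close>, are checked directly.\<close>

lemma exp_minus_Taylor_bound:
  fixes y :: real
  assumes "0 \<le> y"
  shows "\<bar>exp (- y) - (\<Sum>k<n. (-1) ^ k * y ^ k / fact k)\<bar> \<le> y ^ n / fact n"
proof (cases "n = 0 \<or> y = 0")
  case True
  then show ?thesis
    using assms by (cases n) (auto simp: sum.lessThan_Suc_shift)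
next
  case False
  have "\<exists>t>0. t < y \<and>
      exp (- y) = (\<Sum>m<n. (-1) ^ m * exp (- 0) / fact m * y ^ m) + (-1) ^ n * exp (- t) / fact n * y ^ n"
    using False assms by (intro Maclaurin) (auto intro!: derivative_eq_intros)
  then obtain t where "0 < t"
    and "exp (- y) = (\<Sum>m<n. (-1) ^ m * exp (- 0) / fact m * y ^ m) + (-1) ^ n * exp (- t) / fact n * y ^ n"
    by blast
  then have "\<bar>exp (- y) - (\<Sum>k<n. (-1) ^ k * y ^ k / fact k)\<bar> = exp (- t) * (y ^ n / fact n)"
    using assms by (simp add: abs_mult)
  also have "\<dots> \<le> y ^ n / fact n"
    using assms \<open>0 < t\<close> by (intro mult_left_le_one_le) auto
  finally show ?thesis .
qed

text \<open>Integration of the cosine bound. The even moments serve both as coefficients and as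
  error constants.\<close>

lemma (in real_distribution) Re_char_Taylor_bound:
  assumes "\<And>k. integrable M (\<lambda>x. x ^ k)"
  shows "\<bar>Re (char M \<xi>) - (\<Sum>k<n. (-1) ^ k * (expectation (\<lambda>x. x ^ (2 * k)) / fact (2 * k)) * \<xi> ^ (2 * k))\<bar>
    \<le> expectation (\<lambda>x. x ^ (2 * n)) / fact (2 * n) * \<xi> ^ (2 * n)"
proof -
  let ?T = "\<lambda>x. \<Sum>k<n. (-1) ^ k * (\<xi> * x) ^ (2 * k) / fact (2 * k)"
  have pow_int: "integrable M (\<lambda>x. (\<xi> * x) ^ k)" for k
    unfolding power_mult_distrib using assms[of k] by simp
  have cos_int: "integrable M (\<lambda>x. cos (\<xi> * x))"
    by (rule integrable_const_bound[where B = 1]) auto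
  have term_int: "integrable M (\<lambda>x. (-1) ^ k * (\<xi> * x) ^ (2 * k) / fact (2 * k))" for k
    by (intro integrable_divide integrable_mult_right pow_int)
  then have T_int: "integrable M ?T"
    by (intro Bochner_Integration.integrable_sum)
  have "expectation ?T = (\<Sum>k<n. (-1) ^ k * (expectation (\<lambda>x. x ^ (2 * k)) / fact (2 * k)) * \<xi> ^ (2 * k))"
    by (subst Bochner_Integration.integral_sum[OF term_int]) (simp add: power_mult_distrib mult_ac)
  then have "Re (char M \<xi>) - (\<Sum>k<n. (-1) ^ k * (expectation (\<lambda>x. x ^ (2 * k)) / fact (2 * k)) * \<xi> ^ (2 * k))
      = expectation (\<lambda>x. cos (\<xi> * x) - ?T x)"
    using cos_int T_int by (simp add: Re_char)
  also have "\<bar>\<dots>\<bar> \<le> expectation (\<lambda>x. \<bar>cos (\<xi> * x) - ?T x\<bar>)"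
    by (rule integral_abs_bound)
  also have "\<dots> \<le> expectation (\<lambda>x. (\<xi> * x) ^ (2 * n) / fact (2 * n))"
    using cos_int T_int pow_int by (intro integral_mono cos_even_Taylor_bound) auto
  also have "\<dots> = expectation (\<lambda>x. x ^ (2 * n)) / fact (2 * n) * \<xi> ^ (2 * n)"
    by (simp add: power_mult_distrib)
  finally show ?thesis .
qed

section \<open>The imaginary part of a solution\<close>

text \<open>The collision term of a characteristic function is real, so only the loss term acts on
  the imaginary part.\<close>

lemma kac_solution_Im_char:
  assumes "kac_solution \<mu>0 \<mu>" and "0 \<le> t"
  shows "exp t * Im (char (\<mu> t) \<xi>) = Im (char \<mu>0 \<xi>)"
proof -
  have dist: "real_distribution (\<mu> t)" if "0 \<le> t" for t
    using assms that by (auto simp: kac_solution_def)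
  have "((\<lambda>s. exp s * Im (char (\<mu> s) \<xi>)) has_real_derivative 0) (at s within {0..})" if s: "0 \<le> s" for s
  proof -
    interpret real_distribution "\<mu> s"
      by (rule dist[OF s])
    have "((\<lambda>u. char (\<mu> u) \<xi>) has_vector_derivative
        wild_convolution (char (\<mu> s)) (char (\<mu> s)) \<xi> - char (\<mu> s) \<xi>) (at s within {0..})"
      using assms s by (simp add: kac_solution_def solves_fourier_kac_def)
    from bounded_linear.has_vector_derivative[OF bounded_linear_Im this]
    have "((\<lambda>u. Im (char (\<mu> u) \<xi>)) has_real_derivative - Im (char (\<mu> s) \<xi>)) (at s within {0..})"
      using Im_wild_convolution_eq_0[of "char (\<mu> s)" \<xi>] isCont_char
      by (simp add: continuous_at_imp_continuous_on has_real_derivative_iff_has_vector_derivative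
          complex_eq_iff Re_char Im_char)
    from DERIV_mult[OF has_field_derivative_at_within[OF DERIV_exp] this]
    show ?thesis
      by (simp add: mult.commute)
  qed
  then obtain b where "\<forall>s\<in>{0..}. exp s * Im (char (\<mu> s) \<xi>) = b"
    using has_field_derivative_zero_constant[of "{0..}" "\<lambda>s. exp s * Im (char (\<mu> s) \<xi>)"] by auto
  moreover have "char (\<mu> 0) \<xi> = char \<mu>0 \<xi>"
    using assms by (simp add: kac_solution_def solves_fourier_kac_def)
  ultimately show ?thesis
    using assms(2) by (metis atLeast_iff exp_zero mult_1 order_refl)
qed

section \<open>Reduction to the real flow and identification of the moments\<close>

theorem corollary2p5:
  fixes \<mu>0 :: "real measure" and \<mu> :: "real \<Rightarrow> real measure"
    and \<sigma> C :: real and \<rho> :: "real \<Rightarrow> real"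
  assumes "real_distribution \<mu>0"
    and "\<And>k::nat. integrable \<mu>0 (\<lambda>x. x ^ k)"
    and "\<sigma>\<^sup>2 = (LINT x|\<mu>0. x\<^sup>2)"
    and "kac_solution \<mu>0 \<mu>"
    and "\<And>t. t \<ge> 0 \<Longrightarrow> \<rho> t \<ge> 0"
    and "(\<rho> \<longlongrightarrow> 0) at_top"
    and "C > 0"
    and "\<And>t. t \<ge> 0 \<Longrightarrow> tv_dist (\<mu> t) (gaussian \<sigma>) \<le> C * exp (- t) * \<rho> t"
  shows "\<forall>t\<ge>0. \<mu> t = gaussian \<sigma>"
proof -
  interpret \<mu>0: real_distribution \<mu>0
    by (rule assms(1))
  have dist: "real_distribution (\<mu> t)" if "0 \<le> t" for t
    using assms(4) that by (auto simp: kac_solution_def)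
  have char_0: "char (\<mu> 0) \<xi> = char \<mu>0 \<xi>" for \<xi>
    using assms(4) by (simp add: kac_solution_def solves_fourier_kac_def)
  have exp_tv: "exp t * (2 * tv_dist (\<mu> t) (gaussian \<sigma>)) \<le> 2 * C * \<rho> t" if "0 \<le> t" for t
  proof -
    have "exp t * (2 * tv_dist (\<mu> t) (gaussian \<sigma>)) \<le> exp t * (2 * (C * exp (- t) * \<rho> t))"
      by (intro mult_left_mono assms(8) that) auto
    also have "\<dots> = (exp t * exp (- t)) * (2 * C * \<rho> t)"
      by (simp only: mult_ac)
    finally show ?thesis
      by (simp flip: exp_add)
  qed
  have rho_lim: "((\<lambda>t. 2 * C * \<rho> t) \<longlongrightarrow> 0) at_top"
    using tendsto_mult_right_zero[OF assms(6)] .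
  define r where "r = (\<lambda>\<xi> t. Re (char (\<mu> t) \<xi>))"
  define c where "c = \<sigma>\<^sup>2 / 2"
  \<comment> \<open>The Gaussian characteristic function is real, so the time-independent quantity
    \<open>exp t * Im (char (\<mu> t) \<xi>)\<close> is bounded by a multiple of
    \<open>\<rho> t\<close>, which tends to 0.\<close>
  have Im_0: "Im (char \<mu>0 \<xi>) = 0" for \<xi>
  proof -
    have "\<bar>Im (char \<mu>0 \<xi>)\<bar> \<le> 2 * C * \<rho> t" if t: "0 \<le> t" for t
    proof -
      have "\<bar>Im (char (\<mu> t) \<xi>)\<bar> \<le> 2 * tv_dist (\<mu> t) (gaussian \<sigma>)"
        using Re_Im_char_diff_le_tv_dist(2)[OF dist[OF t] real_distribution_gaussian, of \<xi> \<sigma>]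
        by (simp add: char_gaussian)
      then have "exp t * \<bar>Im (char (\<mu> t) \<xi>)\<bar> \<le> 2 * C * \<rho> t"
        using exp_tv[OF t] by (meson exp_ge_zero mult_left_mono order_trans)
      then show ?thesis
        using kac_solution_Im_char[OF assms(4) t, of \<xi>] by (metis abs_exp_cancel abs_mult)
    qed
    then have "\<bar>Im (char \<mu>0 \<xi>)\<bar> \<le> 0"
      by (intro tendsto_lowerbound[OF rho_lim] eventually_mono[OF eventually_ge_at_top[of 0]]) auto
    then show ?thesis
      by simp
  qed
  have char_eq: "char (\<mu> t) \<xi> = complex_of_real (r \<xi> t)" if "0 \<le> t" for \<xi> t
    using kac_solution_Im_char[OF assms(4) that, of \<xi>] by (simp add: complex_eq_iff r_def Im_0)
  interpret real_kac_flow r c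
  proof
    show "0 \<le> c"
      by (simp add: c_def)
    fix t :: real assume t: "0 \<le> t"
    interpret real_distribution "\<mu> t"
      by (rule dist[OF t])
    show "\<bar>r \<xi> t\<bar> \<le> 1" for \<xi>
      using cmod_char_le_1[of \<xi>] abs_Re_le_cmod[of "char (\<mu> t) \<xi>"] by (simp add: r_def)
    show r_cont: "continuous_on UNIV (\<lambda>\<xi>. r \<xi> t)"
      unfolding r_def by (intro continuous_intros continuous_at_imp_continuous_on ballI isCont_char)
    fix \<xi>
    have "((\<lambda>u. char (\<mu> u) \<xi>) has_vector_derivative
        wild_convolution (char (\<mu> t)) (char (\<mu> t)) \<xi> - char (\<mu> t) \<xi>) (at t within {0..})"
      using assms(4) t by (simp add: kac_solution_def solves_fourier_kac_def)
    from bounded_linear.has_vector_derivative[OF bounded_linear_Re this]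
    have "((\<lambda>u. r \<xi> u) has_vector_derivative
        Re (wild_convolution (char (\<mu> t)) (char (\<mu> t)) \<xi>) - r \<xi> t) (at t within {0..})"
      by (simp add: r_def)
    moreover have "wild_convolution (char (\<mu> t)) (char (\<mu> t)) \<xi> =
        complex_of_real (circle_mean (\<lambda>\<theta>. r (\<xi> * cos \<theta>) t * r (\<xi> * sin \<theta>) t))"
    proof -
      have "char (\<mu> t) = (\<lambda>\<eta>. complex_of_real (r \<eta> t))"
        using char_eq[OF t] by auto
      then show ?thesis
        using wild_convolution_of_real[OF r_cont, of \<xi>] by simp
    qed
    ultimately show "((\<lambda>u. r \<xi> u) has_vector_derivative
        circle_mean (\<lambda>\<theta>. r (\<xi> * cos \<theta>) t * r (\<xi> * sin \<theta>) t) - r \<xi> t) (at t within {0..})"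
      by simp
  qed
  have char_gaussian_eq: "char (gaussian \<sigma>) \<xi> = complex_of_real (g \<xi>)" for \<xi>
    unfolding char_gaussian c_def[symmetric] g_def by (rule refl)
  have D_lim: "((\<lambda>t. D \<xi> t) \<longlongrightarrow> 0) at_top" for \<xi>
  proof (rule Lim_null_comparison[OF _ rho_lim])
    show "\<forall>\<^sub>F t in at_top. norm (D \<xi> t) \<le> 2 * C * \<rho> t"
    proof (rule eventually_mono[OF eventually_ge_at_top[of 0]])
      fix t :: real assume t: "0 \<le> t"
      have "\<bar>r \<xi> t - g \<xi>\<bar> \<le> 2 * tv_dist (\<mu> t) (gaussian \<sigma>)"
        using Re_Im_char_diff_le_tv_dist(1)[OF dist[OF t] real_distribution_gaussian, of \<xi> \<sigma>]
        by (simp add: char_gaussian_eq r_def)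
      then have "exp t * \<bar>r \<xi> t - g \<xi>\<bar> \<le> 2 * C * \<rho> t"
        using exp_tv[OF t] by (meson exp_ge_zero mult_left_mono order_trans)
      then show "norm (D \<xi> t) \<le> 2 * C * \<rho> t"
        by (simp add: D_def abs_mult)
    qed
  qed
  \<comment> \<open>Unsigned Taylor coefficients at 0: \<open>M\<close> belongs to the initial
    datum, \<open>G\<close> to the Gaussian. Both start with total mass 1, so their difference
    vanishes at index 0.\<close>
  define M where "M = (\<lambda>k. (LINT x|\<mu>0. x ^ (2 * k)) / fact (2 * k))"
  define G where "G = (\<lambda>k. c ^ k / fact k)"
  have M_0: "M 0 = 1"
    using \<mu>0.prob_space by (simp add: M_def)
  have Taylor: "\<bar>D \<xi> 0 - (\<Sum>k<n. (-1) ^ k * (M k - G k) * \<xi> ^ (2 * k))\<bar> \<le> (M n + G n) * \<xi> ^ (2 * n)" for n \<xi>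
  proof -
    have "\<bar>r \<xi> 0 - (\<Sum>k<n. (-1) ^ k * M k * \<xi> ^ (2 * k))\<bar> \<le> M n * \<xi> ^ (2 * n)"
      using \<mu>0.Re_char_Taylor_bound[OF assms(2), of \<xi> n] by (simp add: M_def r_def char_0)
    moreover have "\<bar>g \<xi> - (\<Sum>k<n. (-1) ^ k * G k * \<xi> ^ (2 * k))\<bar> \<le> G n * \<xi> ^ (2 * n)"
    proof -
      have "(c * \<xi>\<^sup>2) ^ k = c ^ k * \<xi> ^ (2 * k)" for k
        by (simp only: power_mult_distrib power_mult)
      then show ?thesis
        using exp_minus_Taylor_bound[of "c * \<xi>\<^sup>2" n] c_nonneg by (simp add: G_def g_def mult.assoc)
    qed
    moreover have "(\<Sum>k<n. (-1) ^ k * (M k - G k) * \<xi> ^ (2 * k)) =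
        (\<Sum>k<n. (-1) ^ k * M k * \<xi> ^ (2 * k)) - (\<Sum>k<n. (-1) ^ k * G k * \<xi> ^ (2 * k))"
      by (simp add: algebra_simps sum_subtractf)
    moreover have "D \<xi> 0 = r \<xi> 0 - g \<xi>"
      by (simp add: D_def)
    ultimately show ?thesis
      unfolding distrib_right by linarith
  qed
  have "(-1) ^ k * (M k - G k) = 0" for k
    by (rule Taylor_coefficient_eq_0[OF Taylor _ D_lim]) (simp add: M_0 G_def)
  then have M_eq: "M k = G k" for k
    by simp
  have "r \<xi> 0 = g \<xi>" for \<xi>
  proof -
    \<comment> \<open>With equal coefficients the Taylor sum vanishes and only the error remains,
      with constant \<open>2 * G n\<close>. The factorial in \<open>G\<close> sends it to 0 for
      every \<open>\<xi>\<close>, so the Gaussian moments determine the real part.\<close>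
    have "\<bar>D \<xi> 0\<bar> \<le> 2 * ((c * \<xi>\<^sup>2) ^ n / fact n)" for n
      using Taylor[of \<xi> n] by (simp add: M_eq G_def power_mult power_mult_distrib)
    moreover have "(\<lambda>n. 2 * ((c * \<xi>\<^sup>2) ^ n / fact n)) \<longlonglongrightarrow> 2 * 0"
      by (intro tendsto_intros power_over_fact_tendsto_0)
    ultimately have "\<bar>D \<xi> 0\<bar> \<le> 0"
      by (intro LIMSEQ_le_const) auto
    then show ?thesis
      by (simp add: D_def)
  qed
  then have "char (\<mu> t) = char (gaussian \<sigma>)" if "0 \<le> t" for t
    using that by (simp add: fun_eq_iff char_eq char_gaussian_eq r_eq_g)
  then show ?thesis
    using Levy_uniqueness dist real_distribution_gaussian by blast
qed

end
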